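(* Let $q$ be an odd prime, and let $n$ and $k$ be integers with $n>k\ge 1$. For all multiplicative characters $A_0,A_1,\ldots,A_{n-k}$ and $B_1,\ldots,B_{n-k}$ over $\mathbb{F}_q$ and all $x\in\mathbb{F}_q$, $${}_{n+1}F_n\left(\begin{matrix} A_0 & A_1 & \cdots & A_{n-k} & \phi & \cdots & \phi\\ & B_1 & \cdots & B_{n-k} & \epsilon & \cdots & \epsilon\end{matrix}\ \middle|\ x\right)=\frac{\phi(-1)^k}{q}\sum_{b\in\mathbb{F}_q}\phi(b)\;{}_{n+1-k}F_{n-k}\left(\begin{matrix} A_0 & A_1 & \cdots & A_{n-k}\\ & B_1 & \cdots & B_{n-k}\end{matrix}\ \middle|\ bx\right)\;{}_kF_{k-1}\left(\begin{matrix}\phi & \phi & \cdots & \phi\\ & \epsilon & \cdots & \epsilon\end{matrix}\ \middle|\ b\right),$$ where on the left-hand side $\phi$ occurs $k$ times after $A_{n-k}$ and $\epsilon$ occurs $k$ times after $B_{n-k}$, and the last factor on the right has $k$ upper entries $\phi$ and $k-1$ lower entries $\epsilon$.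
   Context: $\mathbb{F}_q$ is the finite field with $q$ elements; $\epsilon$ and $\phi$ are the trivial and quadratic multiplicative characters of $\mathbb{F}_q$. Every multiplicative character $\chi$ (including $\epsilon$) is extended to $\mathbb{F}_q$ by $\chi(0)=0$; $\overline{\chi}$ is the inverse character. For multiplicative characters $A,B$: $J(A,B)=\sum_{x\in\mathbb{F}_q}A(x)B(1-x)$ and $\binom{A}{B}=\frac{B(-1)}{q}J(A,\overline{B})$. For $n\ge 1$, multiplicative characters $A_0,\ldots,A_n,B_1,\ldots,B_n$ and $x\in\mathbb{F}_q$, the Gaussian hypergeometric function is $${}_{n+1}F_n\left(\begin{matrix}A_0 & A_1 & \cdots & A_n\\ & B_1 & \cdots & B_n\end{matrix}\ \middle|\ x\right)=\frac{q}{q-1}\sum_{\chi}\binom{A_0\chi}{\chi}\binom{A_1\chi}{B_1\chi}\cdots\binom{A_n\chi}{B_n\chi}\chi(x),$$ the sum running over all multiplicative characters $\chi$ of $\mathbb{F}_q$; and ${}_1F_0(A\mid x)=\epsilon(x)\overline{A}(1-x)$. *)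

theory Defs
  imports Complex_Main "HOL-Library.Cardinality" "HOL-Computational_Algebra.Primes"
begin

text \<open>The field \<open>F_q\<close> is a type of class \<open>{field, finite}\<close> with \<open>q\<close> elements. A character of its
  multiplicative group is represented by its extension by \<open>0\<close> to the whole field; products of
  characters are pointwise.\<close>

definition mult_chars :: "('a :: {field, finite} \<Rightarrow> complex) set" where
  "mult_chars = {\<chi>. (\<forall>x. \<chi> x = 0 \<longleftrightarrow> x = 0) \<and> (\<forall>x y. \<chi> (x * y) = \<chi> x * \<chi> y)}"

definition triv_char :: "'a :: {field, finite} \<Rightarrow> complex" where
  "triv_char x = (if x = 0 then 0 else 1)"

definition quad_char :: "'a :: {field, finite} \<Rightarrow> complex" where
  "quad_char x = (if x = 0 then 0 else if \<exists>y. x = y\<^sup>2 then 1 else -1)"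

definition char_mult :: "('a :: {field, finite} \<Rightarrow> complex) \<Rightarrow> ('a \<Rightarrow> complex) \<Rightarrow> 'a \<Rightarrow> complex" where
  "char_mult A B = (\<lambda>x. A x * B x)"

text \<open>At \<open>0\<close> this is \<open>inverse 0 = 0\<close>, as required of the extended character.\<close>

definition char_inv :: "('a :: {field, finite} \<Rightarrow> complex) \<Rightarrow> 'a \<Rightarrow> complex" where
  "char_inv A = (\<lambda>x. inverse (A x))"

definition jacobi_sum :: "('a :: {field, finite} \<Rightarrow> complex) \<Rightarrow> ('a \<Rightarrow> complex) \<Rightarrow> complex" where
  "jacobi_sum A B = (\<Sum>x\<in>UNIV. A x * B (1 - x))"

definition char_binom :: "('a :: {field, finite} \<Rightarrow> complex) \<Rightarrow> ('a \<Rightarrow> complex) \<Rightarrow> complex" where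
  "char_binom A B = B (-1) / of_nat CARD('a) * jacobi_sum A (char_inv B)"

text \<open>\<open>hyp_fun n A B x\<close> is the function with the \<open>n + 1\<close> upper parameters \<open>A 0, \<dots>, A n\<close> and the \<open>n\<close>
  lower parameters \<open>B 1, \<dots>, B n\<close>; other values of \<open>A\<close> and \<open>B\<close> are not used.\<close>

definition hyp_fun ::
  "nat \<Rightarrow> (nat \<Rightarrow> 'a :: {field, finite} \<Rightarrow> complex) \<Rightarrow> (nat \<Rightarrow> 'a \<Rightarrow> complex) \<Rightarrow> 'a \<Rightarrow> complex" where
  "hyp_fun n A B x =
     (if n = 0 then triv_char x * char_inv (A 0) (1 - x)
      else of_nat CARD('a) / (of_nat CARD('a) - 1) *
        (\<Sum>\<chi>\<in>mult_chars. char_binom (char_mult (A 0) \<chi>) \<chi> *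
           (\<Prod>i=1..n. char_binom (char_mult (A i) \<chi>) (char_mult (B i) \<chi>)) * \<chi> x))"

text \<open>The sum over all characters in \<open>hyp_fun\<close> is a genuine finite sum.\<close>

lemma finite_mult_chars: "finite (mult_chars :: ('a :: {field, finite} \<Rightarrow> complex) set)"
proof -
  let ?n = "CARD('a) - 1"
  have npos: "?n > 0"
  proof -
    have "card {0, 1 :: 'a} \<le> CARD('a)" by (intro card_mono) auto
    then show ?thesis by simp
  qed
  have fin: "finite (insert 0 {z :: complex. z ^ ?n = 1})"
    using npos by (simp add: finite_roots_unity)
  have "\<chi> a \<in> insert 0 {z. z ^ ?n = 1}" if c: "\<chi> \<in> mult_chars" for \<chi> and a :: 'a
  proof (cases "a = 0")
    case True
    then show ?thesis using c by (auto simp: mult_chars_def)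
  next
    case False
    let ?U = "UNIV - {0 :: 'a}"
    have "bij_betw (\<lambda>x. a * x) ?U ?U"
      by (rule bij_betw_byWitness[where f' = "\<lambda>x. x / a"]) (use False in auto)
    then have "(\<Prod>x\<in>?U. \<chi> x) = (\<Prod>x\<in>?U. \<chi> (a * x))"
      by (simp add: prod.reindex_bij_betw[where g = \<chi>])
    also have "\<dots> = \<chi> a ^ ?n * (\<Prod>x\<in>?U. \<chi> x)"
      using c by (simp add: mult_chars_def prod.distrib card_Diff_singleton)
    finally have "\<chi> a ^ ?n = 1"
      using c by (auto simp: mult_chars_def)
    then show ?thesis by simp
  qed
  then have "mult_chars \<subseteq> {f. \<forall>x :: 'a. (x \<in> UNIV \<longrightarrow> f x \<in> insert 0 {z. z ^ ?n = 1}) \<and>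
      (x \<notin> UNIV \<longrightarrow> f x = 0)}"
    by auto
  then show ?thesis
    by (rule finite_subset) (rule finite_set_of_finite_funs[OF finite fin])
qed

end

theory Submission
  imports Defs
begin

text \<open>Expand the first factor on the right over characters. The coefficient of \<open>\<chi>(x)\<close> then asks for
  the twisted sum \<open>\<Sum>b. \<phi>\<chi>(b) F(b)\<close> of the all-\<open>\<phi>\<close> function \<open>F\<close> with \<open>k\<close> upper entries. For
  \<open>k \<ge> 2\<close>, orthogonality leaves only the character \<open>\<phi>\<chi>\<^sup>-\<^sup>1\<close> in \<open>F\<close>, and symmetry of the Jacobi sum
  turns its coefficient into a power of \<open>binom(\<phi>\<chi>, \<chi>)\<close>. For \<open>k = 1\<close> the sum is the Jacobi sum
  \<open>J(\<phi>\<chi>, \<phi>)\<close>, which the substitution \<open>y = x / (x - 1)\<close> relates to \<open>J(\<phi>\<chi>, \<chi>\<^sup>-\<^sup>1)\<close>.\<close>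

section \<open>Elementary rules for characters extended by zero\<close>

lemma mult_chars_eq_0_iff: "\<chi> \<in> mult_chars \<Longrightarrow> \<chi> x = 0 \<longleftrightarrow> x = 0"
  and mult_chars_mult: "\<chi> \<in> mult_chars \<Longrightarrow> \<chi> (x * y) = \<chi> x * \<chi> y"
  by (simp_all add: mult_chars_def)

lemma mult_chars_1:
  assumes "\<chi> \<in> mult_chars"
  shows "\<chi> 1 = 1"
  using mult_chars_mult[OF assms, of 1 1] mult_chars_eq_0_iff[OF assms, of 1] by simp

lemma mult_chars_inverse:
  assumes "\<chi> \<in> mult_chars"
  shows "\<chi> (inverse x) = inverse (\<chi> x)"
proof (cases "x = 0")
  case True
  then show ?thesis using mult_chars_eq_0_iff[OF assms, of 0] by simp
next
  case False
  then have "\<chi> x * \<chi> (inverse x) = 1"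
    using mult_chars_mult[OF assms, of x "inverse x"] mult_chars_1[OF assms] by simp
  then show ?thesis by (metis inverse_unique)
qed

lemma mult_chars_minus_1_square:
  assumes "\<chi> \<in> mult_chars"
  shows "\<chi> (-1) * \<chi> (-1) = 1"
  using mult_chars_mult[OF assms, of "-1" "-1"] mult_chars_1[OF assms] by simp

lemma char_inv_minus_1:
  assumes "\<chi> \<in> mult_chars"
  shows "char_inv \<chi> (-1) = \<chi> (-1)"
  unfolding char_inv_def
  using mult_chars_minus_1_square[OF assms] by (metis inverse_unique)

lemma char_mult_in_mult_chars:
  "\<chi> \<in> mult_chars \<Longrightarrow> \<psi> \<in> mult_chars \<Longrightarrow> char_mult \<chi> \<psi> \<in> mult_chars"
  by (auto simp: mult_chars_def char_mult_def)

lemma char_inv_in_mult_chars: "\<chi> \<in> mult_chars \<Longrightarrow> char_inv \<chi> \<in> mult_chars"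
  by (auto simp: mult_chars_def char_inv_def)

lemma triv_char_mult:
  assumes "\<chi> \<in> mult_chars"
  shows "char_mult triv_char \<chi> = \<chi>"
  using mult_chars_eq_0_iff[OF assms] by (auto simp: char_mult_def triv_char_def)

section \<open>Orthogonality of characters\<close>

lemma sum_char_eq_0:
  fixes \<chi> :: "'a :: {field, finite} \<Rightarrow> complex"
  assumes c: "\<chi> \<in> mult_chars" and "\<chi> \<noteq> triv_char"
  shows "(\<Sum>x\<in>UNIV. \<chi> x) = 0"
proof -
  \<comment> \<open>Both characters vanish at \<open>0\<close>, so they differ at a unit
    \<open>a\<close> with \<open>\<chi> a \<noteq> 1\<close>. Rescaling the sum by \<open>a\<close>
    multiplies it by \<open>\<chi> a\<close>, which forces it to be \<open>0\<close>.\<close>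
  obtain a where a: "\<chi> a \<noteq> triv_char a" using assms(2) by blast
  then have a0: "a \<noteq> 0" and a1: "\<chi> a \<noteq> 1"
    using mult_chars_eq_0_iff[OF c, of a] by (auto simp: triv_char_def split: if_splits)
  have "bij_betw (\<lambda>x. a * x) UNIV UNIV"
    by (rule bij_betw_byWitness[where f' = "\<lambda>x. x / a"]) (use a0 in auto)
  then have "(\<Sum>x\<in>UNIV. \<chi> x) = (\<Sum>x\<in>UNIV. \<chi> (a * x))"
    by (simp add: sum.reindex_bij_betw[where g = \<chi>])
  also have "\<dots> = \<chi> a * (\<Sum>x\<in>UNIV. \<chi> x)"
    by (simp add: mult_chars_mult[OF c] sum_distrib_left)
  finally show ?thesis using a1 by simp
qed

lemma sum_triv_char:
  "(\<Sum>x\<in>UNIV. triv_char (x :: 'a :: {field, finite})) = of_nat CARD('a) - 1"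
proof -
  have "(\<Sum>x\<in>UNIV. triv_char (x :: 'a)) = (\<Sum>x\<in>UNIV - {0 :: 'a}. 1)"
    by (rule sum.mono_neutral_cong_right) (auto simp: triv_char_def)
  then show ?thesis by (simp add: card_Diff_singleton of_nat_diff Suc_leI)
qed

lemma char_mult_eq_triv_iff:
  assumes "\<chi> \<in> mult_chars" "\<psi> \<in> mult_chars"
  shows "char_mult \<chi> \<psi> = triv_char \<longleftrightarrow> \<psi> = char_inv \<chi>"
proof -
  have "\<chi> x * \<psi> x = triv_char x \<longleftrightarrow> \<psi> x = inverse (\<chi> x)" for x
    using mult_chars_eq_0_iff[OF assms(1), of x] mult_chars_eq_0_iff[OF assms(2), of x]
    by (auto simp: triv_char_def field_simps)
  then show ?thesis by (simp add: char_mult_def char_inv_def fun_eq_iff)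
qed

lemma sum_char_orthogonal:
  fixes \<chi> \<psi> :: "'a :: {field, finite} \<Rightarrow> complex"
  assumes "\<chi> \<in> mult_chars" "\<psi> \<in> mult_chars"
  shows "(\<Sum>x\<in>UNIV. \<chi> x * \<psi> x) = (if \<psi> = char_inv \<chi> then of_nat CARD('a) - 1 else 0)"
proof -
  have "(\<Sum>x\<in>UNIV. \<chi> x * \<psi> x) = (\<Sum>x\<in>UNIV. char_mult \<chi> \<psi> x)"
    by (simp add: char_mult_def)
  then show ?thesis
    using sum_char_eq_0[OF char_mult_in_mult_chars[OF assms]] char_mult_eq_triv_iff[OF assms]
    by (auto simp: sum_triv_char)
qed

section \<open>Symmetries of Jacobi sums\<close>

lemma jacobi_sum_commute: "jacobi_sum A B = jacobi_sum B A"
proof -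
  have "bij_betw (\<lambda>x :: 'a. 1 - x) UNIV UNIV"
    by (rule bij_betw_byWitness[where f' = "\<lambda>x. 1 - x"]) auto
  from sum.reindex_bij_betw[OF this, of "\<lambda>x. B x * A (1 - x)"] show ?thesis
    by (simp add: jacobi_sum_def mult.commute)
qed

text \<open>The map \<open>y = x / (x - 1)\<close> is an involution of the field without
  \<open>1\<close> and satisfies \<open>1 - y = 1 / (1 - x)\<close>. Hence \<open>B (1 - y)\<close>
  becomes \<open>1 / B (1 - x)\<close>, while \<open>A y\<close> contributes
  \<open>A (-1) * A x / A (1 - x)\<close>; the two denominators combine into the inverse of the
  product character.\<close>

lemma jacobi_sum_transform:
  fixes A B :: "'a :: {field, finite} \<Rightarrow> complex"
  assumes A: "A \<in> mult_chars" and B: "B \<in> mult_chars"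
  shows "jacobi_sum A B = A (-1) * jacobi_sum A (char_inv (char_mult A B))"
proof -
  let ?U = "UNIV - {1 :: 'a}"
  let ?s = "\<lambda>x :: 'a. x / (x - 1)"
  have B0: "B 0 = 0" using mult_chars_eq_0_iff[OF B] by simp
  have A0: "A 0 = 0" using mult_chars_eq_0_iff[OF A] by simp
  have ne: "?s x \<noteq> 1" and inv: "?s (?s x) = x" and one_minus: "1 - ?s x = inverse (1 - x)"
    if "x \<noteq> 1" for x
  proof -
    have d: "x - 1 \<noteq> 0" using that by simp
    show "?s x \<noteq> 1" using d by (simp add: divide_eq_eq)
    have e: "?s x - 1 = inverse (x - 1)" using d by (simp add: field_simps)
    show "?s (?s x) = x" unfolding e using d by simp
    have "1 - ?s x = - inverse (x - 1)" using e by (simp add: algebra_simps)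
    then show "1 - ?s x = inverse (1 - x)" by (metis inverse_minus_eq minus_diff_eq)
  qed
  have bij: "bij_betw ?s ?U ?U"
    by (rule bij_betw_byWitness[where f' = ?s]) (use ne inv in auto)
  have "jacobi_sum A B = (\<Sum>x\<in>?U. A x * B (1 - x))"
    unfolding jacobi_sum_def by (rule sum.mono_neutral_right) (auto simp: B0)
  also have "\<dots> = (\<Sum>x\<in>?U. A (?s x) * B (1 - ?s x))"
    using sum.reindex_bij_betw[OF bij, of "\<lambda>x. A x * B (1 - x)"] by simp
  also have "\<dots> = (\<Sum>x\<in>?U. A (-1) * (A x * char_inv (char_mult A B) (1 - x)))"
  proof (rule sum.cong)
    fix x assume "x \<in> ?U"
    then have x: "x \<noteq> 1" by simp
    have "?s x = (-1) * (x * inverse (1 - x))"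
      using x by (simp add: field_simps)
    then have "A (?s x) = A (-1) * (A x * inverse (A (1 - x)))"
      by (simp only: mult_chars_mult[OF A] mult_chars_inverse[OF A])
    moreover have "B (1 - ?s x) = inverse (B (1 - x))"
      by (simp only: one_minus[OF x] mult_chars_inverse[OF B])
    ultimately show "A (?s x) * B (1 - ?s x) =
        A (-1) * (A x * char_inv (char_mult A B) (1 - x))"
      by (simp add: char_inv_def char_mult_def)
  qed simp
  also have "\<dots> = A (-1) * jacobi_sum A (char_inv (char_mult A B))"
    \<comment> \<open>The point \<open>1\<close> can be restored because the inverse character is
      \<open>inverse 0 = 0\<close> at \<open>1 - 1\<close>.\<close>
    unfolding jacobi_sum_def sum_distrib_left
    by (rule sum.mono_neutral_left) (auto simp: char_inv_def char_mult_def A0)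
  finally show ?thesis .
qed

section \<open>Multiplicativity of the quadratic character\<close>

lemma card_nonzero_le_twice_card_squares:
  fixes U :: "'a :: {field, finite} set"
  defines "U \<equiv> UNIV - {0}"
  shows "card U \<le> 2 * card ((\<lambda>y. y\<^sup>2) ` U)"
proof -
  let ?S = "(\<lambda>y. y\<^sup>2) ` U"
  have "card {y \<in> U. y\<^sup>2 = s} \<le> 2" if s: "s \<in> ?S" for s
  proof -
    obtain z where z: "s = z\<^sup>2" using s by blast
    \<comment> \<open>In characteristic \<open>2\<close> the roots \<open>z\<close> and
      \<open>- z\<close> coincide, so the fibres of squaring are only bounded by two.\<close>
    have "{y \<in> U. y\<^sup>2 = s} \<subseteq> {z, - z}" by (auto simp: z power2_eq_iff)
    then have "card {y \<in> U. y\<^sup>2 = s} \<le> card {z, - z}" by (intro card_mono) auto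
    also have "\<dots> \<le> 2" by (simp add: card_insert_if)
    finally show ?thesis .
  qed
  then have "(\<Sum>s\<in>?S. card {y \<in> U. y\<^sup>2 = s}) \<le> (\<Sum>s\<in>?S. 2)" by (rule sum_mono)
  moreover have "card U = (\<Sum>s\<in>?S. card {y \<in> U. y\<^sup>2 = s})"
    using sum.image_gen[of U "\<lambda>_. 1 :: nat" "\<lambda>y. y\<^sup>2"] by simp
  ultimately show ?thesis by (simp add: mult.commute)
qed

text \<open>Multiplication by a nonsquare \<open>a\<close> maps the squares into the nonsquares; since at least half of
  the units are squares, it is onto.\<close>

lemma nonsquare_mult_nonsquare:
  fixes a b :: "'a :: {field, finite}"
  assumes a: "\<nexists>y. a = y\<^sup>2" and b: "\<nexists>y. b = y\<^sup>2"
  shows "\<exists>y. a * b = y\<^sup>2"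
proof -
  define U :: "'a set" where "U = UNIV - {0}"
  define S where "S = (\<lambda>y. y\<^sup>2) ` U"
  have a0: "a \<noteq> 0" and b0: "b \<noteq> 0"
    using a b by (auto dest: spec[of _ 0])
  have SU: "S \<subseteq> U" by (auto simp: S_def U_def)
  have sub: "(\<lambda>s. a * s) ` S \<subseteq> U - S"
  proof clarify
    fix s assume s: "s \<in> S"
    then obtain z where z: "z \<noteq> 0" "s = z\<^sup>2" by (auto simp: S_def U_def)
    have "a * s \<notin> S"
    proof
      assume "a * s \<in> S"
      then obtain w where "a * s = w\<^sup>2" by (auto simp: S_def)
      then have "a = (w / z)\<^sup>2" using z by (simp add: power_divide field_simps)
      then show False using a by blast
    qed
    then show "a * s \<in> U - S" using a0 z by (simp add: U_def)
  qed
  have "card U \<le> 2 * card S"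
    using card_nonzero_le_twice_card_squares unfolding S_def U_def .
  then have "card (U - S) \<le> card ((\<lambda>s. a * s) ` S)"
    using SU a0 by (simp add: card_Diff_subset card_image inj_on_def)
  with sub have "(\<lambda>s. a * s) ` S = U - S" by (intro card_seteq) auto
  moreover have "b \<in> U - S" using b b0 by (auto simp: U_def S_def)
  ultimately obtain z where "b = a * z\<^sup>2" by (force simp: S_def)
  then have "a * b = (a * z)\<^sup>2" by (simp add: power2_eq_square)
  then show ?thesis by blast
qed

text \<open>Multiplying by a nonzero square does not change whether an element is a square. This
  settles every product of units except that of two nonsquares, where the counting argument is
  needed.\<close>

lemma quad_char_in_mult_chars: "quad_char \<in> (mult_chars :: ('a :: {field, finite} \<Rightarrow> complex) set)"
proof -
  have square: "(\<exists>y. a * b = y\<^sup>2) \<longleftrightarrow> (\<exists>y. b = y\<^sup>2)" if a: "a \<noteq> 0" "\<exists>y. a = y\<^sup>2"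
    for a b :: 'a
  proof -
    obtain z where z: "a = z\<^sup>2" "z \<noteq> 0" using a by auto
    show ?thesis
    proof
      assume "\<exists>y. a * b = y\<^sup>2"
      then obtain y where "a * b = y\<^sup>2" by blast
      then have "b = (y / z)\<^sup>2" using z by (simp add: power_divide field_simps)
      then show "\<exists>y. b = y\<^sup>2" by blast
    next
      assume "\<exists>y. b = y\<^sup>2"
      then show "\<exists>y. a * b = y\<^sup>2" using z by (metis power_mult_distrib)
    qed
  qed
  have "quad_char (a * b) = quad_char a * quad_char b" for a b :: 'a
  proof (cases "a = 0 \<or> b = 0")
    case True
    then show ?thesis by (auto simp: quad_char_def)
  next
    case False
    consider "\<exists>y. a = y\<^sup>2" | "\<exists>y. b = y\<^sup>2" | "\<nexists>y. a = y\<^sup>2" "\<nexists>y. b = y\<^sup>2" by blast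
    then show ?thesis
    proof cases
      case 1
      then show ?thesis using square[of a b] False by (simp add: quad_char_def)
    next
      case 2
      then show ?thesis using square[of b a] False by (simp add: quad_char_def mult.commute)
    next
      case 3
      then show ?thesis using nonsquare_mult_nonsquare[OF 3] False by (simp add: quad_char_def)
    qed
  qed
  then show ?thesis by (simp add: mult_chars_def quad_char_def)
qed

lemma char_inv_quad_char: "char_inv quad_char = quad_char"
  by (auto simp: char_inv_def quad_char_def)

lemma quad_char_square: "quad_char x * quad_char x = triv_char x"
  by (simp add: quad_char_def triv_char_def)

section \<open>Binomials of \<open>\<phi>\<chi>\<close> over \<open>\<chi>\<close> and the twisted
  sum\<close>

lemma char_binom_quad_char:
  fixes \<chi> :: "'a :: {field, finite} \<Rightarrow> complex"
  assumes c: "\<chi> \<in> mult_chars"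
  shows "char_binom (char_mult quad_char \<chi>) \<chi> =
    quad_char (-1 :: 'a) / of_nat CARD('a) * jacobi_sum (char_mult quad_char \<chi>) quad_char"
proof -
  let ?A = "char_mult quad_char \<chi>"
  \<comment> \<open>The square of \<open>\<phi>\<close> is \<open>triv_char\<close>, not the
    constant \<open>1\<close>; it is absorbed because \<open>\<chi>\<close> also vanishes at
    \<open>0\<close>.\<close>
  have "char_mult ?A quad_char = \<chi>"
    using triv_char_mult[OF c] by (simp add: char_mult_def fun_eq_iff quad_char_square[symmetric] mult_ac)
  then have "jacobi_sum ?A quad_char = ?A (-1) * jacobi_sum ?A (char_inv \<chi>)"
    using jacobi_sum_transform[OF char_mult_in_mult_chars[OF quad_char_in_mult_chars c]
        quad_char_in_mult_chars] by simp
  moreover have "quad_char (-1 :: 'a) * ?A (-1) = \<chi> (-1)"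
    using mult_chars_minus_1_square[OF quad_char_in_mult_chars, where ?'a = 'a]
    by (simp add: char_mult_def mult.assoc[symmetric])
  ultimately show ?thesis by (simp add: char_binom_def mult.assoc[symmetric])
qed

text \<open>Here \<open>\<psi>\<close> is the character that survives orthogonality in the twisted
  sum. Since \<open>\<phi>\<psi>\<close> is the inverse of \<open>\<chi>\<close> and the inverse of
  \<open>\<psi>\<close> is \<open>\<phi>\<chi>\<close>, the two Jacobi sums differ only by swapping
  arguments. The signs \<open>\<psi>(-1)\<close> and \<open>\<chi>(-1)\<close> differ by
  \<open>\<phi>(-1)\<close>.\<close>

lemma char_binom_quad_char_reflect:
  fixes \<chi> :: "'a :: {field, finite} \<Rightarrow> complex"
  assumes c: "\<chi> \<in> mult_chars"
  defines "\<psi> \<equiv> char_inv (char_mult quad_char \<chi>)"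
  shows "quad_char (-1 :: 'a) * char_binom (char_mult quad_char \<psi>) \<psi> =
    char_binom (char_mult quad_char \<chi>) \<chi>"
proof -
  have q: "inverse (quad_char x) = quad_char x" for x :: 'a
    using char_inv_quad_char by (metis char_inv_def)
  have A: "char_mult quad_char \<chi> \<in> mult_chars"
    by (rule char_mult_in_mult_chars[OF quad_char_in_mult_chars c])
  have "char_mult quad_char \<psi> = char_inv \<chi>"
    using triv_char_mult[OF char_inv_in_mult_chars[OF c]]
    by (simp add: \<psi>_def char_mult_def char_inv_def fun_eq_iff q quad_char_square[symmetric] mult_ac)
  moreover have "char_inv \<psi> = char_mult quad_char \<chi>"
    by (simp add: \<psi>_def char_inv_def)
  moreover have "quad_char (-1 :: 'a) * \<psi> (-1) = \<chi> (-1)"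
    unfolding \<psi>_def char_inv_minus_1[OF A]
    using mult_chars_minus_1_square[OF quad_char_in_mult_chars, where ?'a = 'a]
    by (simp add: char_mult_def mult.assoc[symmetric])
  ultimately show ?thesis
    by (simp add: char_binom_def jacobi_sum_commute[of "char_inv \<chi>"] mult.assoc[symmetric])
qed

text \<open>Lets the value \<open>q - 1\<close> from orthogonality cancel the denominator in
  \<open>hyp_fun\<close>.\<close>

lemma card_field_ne_1: "(of_nat CARD('a :: {field, finite}) :: complex) - 1 \<noteq> 0"
proof -
  have "card {0, 1 :: 'a} \<le> CARD('a)" by (intro card_mono) auto
  then have "CARD('a) \<noteq> 1" by simp
  then show ?thesis by (metis eq_iff_diff_eq_0 of_nat_eq_1_iff)
qed

text \<open>This is the theorem coefficient by coefficient: the twist by \<open>\<chi>\<close>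
  yields exactly the \<open>k\<close> additional binomials of the longer series.\<close>

lemma sum_quad_hyp_fun:
  fixes \<chi> :: "'a :: {field, finite} \<Rightarrow> complex"
  assumes c: "\<chi> \<in> mult_chars" and k: "k \<ge> 1"
  shows "quad_char (-1 :: 'a) ^ k / of_nat CARD('a) *
      (\<Sum>b\<in>UNIV. quad_char b * \<chi> b * hyp_fun (k - 1) (\<lambda>_. quad_char) (\<lambda>_. triv_char) b) =
    char_binom (char_mult quad_char \<chi>) \<chi> ^ k"
proof (cases "k = 1")
  case True
  \<comment> \<open>\<open>hyp_fun 0\<close> is a closed form instead of a character sum. Its factor
    \<open>triv_char b\<close> is absorbed by \<open>quad_char b\<close>, leaving a Jacobi
    sum.\<close>
  have "(\<Sum>b\<in>UNIV. quad_char b * \<chi> b * hyp_fun 0 (\<lambda>_. quad_char) (\<lambda>_. triv_char) b) =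
      jacobi_sum (char_mult quad_char \<chi>) quad_char"
    unfolding jacobi_sum_def
    by (rule sum.cong) (auto simp: hyp_fun_def char_inv_quad_char char_mult_def triv_char_def
        quad_char_def)
  then show ?thesis using True char_binom_quad_char[OF c] by simp
next
  case False
  let ?q = "of_nat CARD('a) :: complex"
  let ?g = "\<lambda>\<psi> :: 'a \<Rightarrow> complex. char_binom (char_mult quad_char \<psi>) \<psi>"
  let ?\<psi> = "char_inv (char_mult quad_char \<chi>)"
  have A: "char_mult quad_char \<chi> \<in> mult_chars"
    by (rule char_mult_in_mult_chars[OF quad_char_in_mult_chars c])
  have char_mult_apply: "char_mult quad_char \<chi> b = quad_char b * \<chi> b" for b
    by (simp add: char_mult_def)
  \<comment> \<open>As \<open>\<epsilon>\<psi> = \<psi>\<close>, the \<open>k - 1\<close> factors of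
    the product equal the leading one, which gives a \<open>k\<close>-th power.\<close>
  have hyp: "hyp_fun (k - 1) (\<lambda>_. quad_char) (\<lambda>_. triv_char) b =
      ?q / (?q - 1) * (\<Sum>\<psi>\<in>mult_chars. ?g \<psi> ^ k * \<psi> b)" for b :: 'a
  proof -
    have "?g \<psi> * (\<Prod>i=1..k-1. char_binom (char_mult quad_char \<psi>) (char_mult triv_char \<psi>)) =
        ?g \<psi> ^ k" if "\<psi> \<in> mult_chars" for \<psi>
      using k triv_char_mult[OF that] by (simp add: power_eq_if)
    then show ?thesis using k False by (simp add: hyp_fun_def)
  qed
  have "(\<Sum>b\<in>UNIV. quad_char b * \<chi> b * hyp_fun (k - 1) (\<lambda>_. quad_char) (\<lambda>_. triv_char) b) =
      (\<Sum>b\<in>UNIV. \<Sum>\<psi>\<in>mult_chars. ?q / (?q - 1) * ?g \<psi> ^ k * (char_mult quad_char \<chi> b * \<psi> b))"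
    by (simp only: hyp sum_distrib_left char_mult_apply mult_ac)
  also have "\<dots> = (\<Sum>\<psi>\<in>mult_chars. ?q / (?q - 1) * ?g \<psi> ^ k *
      (\<Sum>b\<in>UNIV. char_mult quad_char \<chi> b * \<psi> b))"
    by (subst sum.swap) (simp add: sum_distrib_left)
  also have "\<dots> = (\<Sum>\<psi>\<in>mult_chars. if \<psi> = ?\<psi> then ?q / (?q - 1) * ?g \<psi> ^ k * (?q - 1) else 0)"
    by (intro sum.cong) (simp_all add: sum_char_orthogonal[OF A])
  also have "\<dots> = ?q * ?g ?\<psi> ^ k"
    using char_inv_in_mult_chars[OF A] card_field_ne_1[where ?'a = 'a]
    by (simp add: finite_mult_chars)
  \<comment> \<open>The sign \<open>\<phi>(-1)^k\<close> is spent on reflecting each of the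
    \<open>k\<close> binomials from \<open>?\<psi>\<close> back to \<open>\<chi>\<close>; the factor
    \<open>q\<close> cancels the \<open>1 / q\<close>.\<close>
  finally show ?thesis
    by (simp add: char_binom_quad_char_reflect[OF c, symmetric] power_mult_distrib)
qed

theorem theorem3p1:
  fixes n k q :: nat
    and A B :: "nat \<Rightarrow> 'a :: {field, finite} \<Rightarrow> complex"
    and x :: 'a
  assumes "CARD('a) = q" and "prime q" and "odd q"
    and "k \<ge> 1" and "n > k"
    and "\<And>i. i \<le> n - k \<Longrightarrow> A i \<in> mult_chars"
    and "\<And>i. 1 \<le> i \<Longrightarrow> i \<le> n - k \<Longrightarrow> B i \<in> mult_chars"
  shows "hyp_fun n (\<lambda>i. if i \<le> n - k then A i else quad_char)
                   (\<lambda>i. if i \<le> n - k then B i else triv_char) x =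
    quad_char (-1 :: 'a) ^ k / of_nat q *
      (\<Sum>b\<in>UNIV. quad_char b * hyp_fun (n - k) A B (b * x) *
         hyp_fun (k - 1) (\<lambda>_. quad_char) (\<lambda>_. triv_char) b)"
proof -
  define m where "m = n - k"
  define F :: "('a \<Rightarrow> complex) \<Rightarrow> complex" where
    "F \<chi> = char_binom (char_mult (A 0) \<chi>) \<chi> *
      (\<Prod>i=1..m. char_binom (char_mult (A i) \<chi>) (char_mult (B i) \<chi>))" for \<chi>
  let ?q = "of_nat CARD('a) :: complex"
  let ?g = "\<lambda>\<chi> :: 'a \<Rightarrow> complex. char_binom (char_mult quad_char \<chi>) \<chi>"
  let ?G = "hyp_fun (k - 1) (\<lambda>_. quad_char) (\<lambda>_. triv_char) :: 'a \<Rightarrow> complex"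
  let ?A = "\<lambda>i. if i \<le> m then A i else quad_char"
  let ?B = "\<lambda>i. if i \<le> m then B i else triv_char"
  \<comment> \<open>Positivity of \<open>m\<close> ensures that both \<open>hyp_fun m\<close> and
    \<open>hyp_fun n\<close> are given by character sums.\<close>
  have m: "m > 0" and n: "n = m + k" using assms(5) by (auto simp: m_def)
  have split: "(\<Prod>i=1..n. char_binom (char_mult (?A i) \<chi>) (char_mult (?B i) \<chi>)) =
      (\<Prod>i=1..m. char_binom (char_mult (A i) \<chi>) (char_mult (B i) \<chi>)) * ?g \<chi> ^ k"
    if "\<chi> \<in> mult_chars" for \<chi>
    unfolding n using triv_char_mult[OF that] by (simp add: prod.ub_add_nat)
  have lhs: "hyp_fun n ?A ?B x = ?q / (?q - 1) * (\<Sum>\<chi>\<in>mult_chars. F \<chi> * ?g \<chi> ^ k * \<chi> x)"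
    using m n split by (simp add: hyp_fun_def F_def mult.assoc)
  have rhs: "hyp_fun m A B y = ?q / (?q - 1) * (\<Sum>\<chi>\<in>mult_chars. F \<chi> * \<chi> y)" for y
    using m by (simp add: hyp_fun_def F_def)
  \<comment> \<open>Writing \<open>\<chi>(b x)\<close> as \<open>\<chi>(b) \<chi>(x)\<close>
    separates the variables, so that for each \<open>\<chi>\<close> only a twisted sum over
    \<open>b\<close> remains.\<close>
  have "(\<Sum>b\<in>UNIV. quad_char b * hyp_fun m A B (b * x) * ?G b) =
      (\<Sum>b\<in>UNIV. \<Sum>\<chi>\<in>mult_chars.
        ?q / (?q - 1) * F \<chi> * \<chi> x * (quad_char b * \<chi> b * ?G b))"
    by (simp add: rhs sum_distrib_left sum_distrib_right mult_chars_mult mult_ac)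
  also have "\<dots> = (\<Sum>\<chi>\<in>mult_chars.
      ?q / (?q - 1) * F \<chi> * \<chi> x * (\<Sum>b\<in>UNIV. quad_char b * \<chi> b * ?G b))"
    by (subst sum.swap) (simp only: sum_distrib_left)
  finally have "quad_char (-1 :: 'a) ^ k / ?q *
      (\<Sum>b\<in>UNIV. quad_char b * hyp_fun m A B (b * x) * ?G b) =
      (\<Sum>\<chi>\<in>mult_chars. ?q / (?q - 1) * F \<chi> * \<chi> x *
        (quad_char (-1 :: 'a) ^ k / ?q * (\<Sum>b\<in>UNIV. quad_char b * \<chi> b * ?G b)))"
    by (simp only: sum_distrib_left mult_ac)
  also have "\<dots> = (\<Sum>\<chi>\<in>mult_chars. ?q / (?q - 1) * F \<chi> * \<chi> x * ?g \<chi> ^ k)"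
    by (rule sum.cong) (simp_all only: sum_quad_hyp_fun[OF _ assms(4)])
  also have "\<dots> = hyp_fun n ?A ?B x"
    unfolding lhs sum_distrib_left by (simp only: mult_ac)
  finally show ?thesis unfolding m_def assms(1) by simp
qed

end
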